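(* For any $k\in\mathbb{N}$ (positive integer), there exists a graph $G$ with $\operatorname{dom}(G)\geq k$ and $\operatorname{dom}_g(G,X)=1$ for each $X\in\{A,B\}$.
   Context: All graphs are finite and simple. A set $S\subseteq V(G)$ is dominating if every vertex of $G$ is in $S$ or adjacent to a vertex of $S$. The domatic number $\operatorname{dom}(G)$ is the largest number of parts in a partition of $V(G)$ into dominating sets. The domatic game on $G$ with palette size $k$: players Alice and Bob alternately choose an uncolored vertex of $G$ and color it with a color from $[k]=\{1,\dots,k\}$, until every vertex is colored. Alice wins if for every $c\in[k]$ the set of vertices colored $c$ is a dominating set of $G$; otherwise Bob wins. For $X\in\{A,B\}$, $X$ indicates who moves first ($A$ = Alice, $B$ = Bob). The domatic game number $\operatorname{dom}_g(G,X)$ is the largest $k$ such that Alice has a winning strategy in the domatic game on $G$ with palette size $k$ when $X$ moves first. *)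

theory Defs
  imports "Graph_Theory.Pair_Digraph" "HOL-Library.Disjoint_Sets"
begin

text \<open>
  Finite simple graphs are the \<^const>\<open>pair_graph\<close>s: finite, loop-free, symmetric sets of
  ordered pairs, so \<open>(u, v) \<in> parcs G\<close> says that \<open>u\<close> and \<open>v\<close> are adjacent.
\<close>

definition dominating_set :: "'a pair_pre_digraph \<Rightarrow> 'a set \<Rightarrow> bool" where
  "dominating_set G S \<longleftrightarrow>
     S \<subseteq> pverts G \<and> (\<forall>v\<in>pverts G. v \<in> S \<or> (\<exists>u\<in>S. (u, v) \<in> parcs G))"

text \<open>
  The sets whose maximum is taken here and in \<open>domatic_game_number\<close> below are finite and
  nonempty for a finite graph with at least one vertex; in both cases the members are bounded by
  the number of vertices, since a dominating set is then nonempty.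
\<close>

definition domatic_number :: "'a pair_pre_digraph \<Rightarrow> nat" where
  "domatic_number G =
     Max {card P | P. partition_on (pverts G) P \<and> (\<forall>S\<in>P. dominating_set G S)}"

datatype player = Alice | Bob

fun opponent :: "player \<Rightarrow> player" where
  "opponent Alice = Bob"
| "opponent Bob = Alice"

text \<open>
  A history lists the moves made so far, earliest first; the move \<open>(v, c)\<close> colors the vertex
  \<open>v\<close> with the color \<open>c\<close>.
\<close>

type_synonym 'a history = "('a \<times> nat) list"

definition legal_history :: "'a pair_pre_digraph \<Rightarrow> nat \<Rightarrow> 'a history \<Rightarrow> bool" where
  "legal_history G k h \<longleftrightarrow>
     distinct (map fst h) \<and> fst ` set h \<subseteq> pverts G \<and> snd ` set h \<subseteq> {1..k}"

definition complete_history :: "'a pair_pre_digraph \<Rightarrow> 'a history \<Rightarrow> bool" where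
  "complete_history G h \<longleftrightarrow> fst ` set h = pverts G"

definition to_move :: "player \<Rightarrow> 'a history \<Rightarrow> player" where
  "to_move X h = (if even (length h) then X else opponent X)"

definition color_class :: "'a history \<Rightarrow> nat \<Rightarrow> 'a set" where
  "color_class h c = {v. (v, c) \<in> set h}"

definition Alice_wins :: "'a pair_pre_digraph \<Rightarrow> nat \<Rightarrow> 'a history \<Rightarrow> bool" where
  "Alice_wins G k h \<longleftrightarrow> (\<forall>c\<in>{1..k}. dominating_set G (color_class h c))"

text \<open>
  A strategy for Alice in the game in which \<open>X\<close> moves first prescribes a legal move at every
  unfinished history at which she is to move. Its values at other histories are irrelevant.
\<close>

definition Alice_strategy ::
  "'a pair_pre_digraph \<Rightarrow> nat \<Rightarrow> player \<Rightarrow> ('a history \<Rightarrow> 'a \<times> nat) \<Rightarrow> bool" where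
  "Alice_strategy G k X \<sigma> \<longleftrightarrow>
     (\<forall>h. legal_history G k h \<and> \<not> complete_history G h \<and> to_move X h = Alice
        \<longrightarrow> legal_history G k (h @ [\<sigma> h]))"

definition follows :: "player \<Rightarrow> ('a history \<Rightarrow> 'a \<times> nat) \<Rightarrow> 'a history \<Rightarrow> bool" where
  "follows X \<sigma> h \<longleftrightarrow>
     (\<forall>i<length h. to_move X (take i h) = Alice \<longrightarrow> h ! i = \<sigma> (take i h))"

definition winning_strategy ::
  "'a pair_pre_digraph \<Rightarrow> nat \<Rightarrow> player \<Rightarrow> ('a history \<Rightarrow> 'a \<times> nat) \<Rightarrow> bool" where
  "winning_strategy G k X \<sigma> \<longleftrightarrow>
     Alice_strategy G k X \<sigma> \<and>
     (\<forall>h. legal_history G k h \<and> complete_history G h \<and> follows X \<sigma> h \<longrightarrow> Alice_wins G k h)"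

definition domatic_game_number :: "'a pair_pre_digraph \<Rightarrow> player \<Rightarrow> nat" where
  "domatic_game_number G X = Max {k. 1 \<le> k \<and> (\<exists>\<sigma>. winning_strategy G k X \<sigma>)}"

end

theory Submission
  imports Defs "HOL-Library.Nat_Bijection"
begin

text \<open>
  Take a clique whose vertices are split into \<open>k\<close> large groups, and for every set \<open>S\<close> of clique
  vertices that meets all the groups add many further vertices whose neighborhood is exactly \<open>S\<close>.
  Since every closed neighborhood meets every group, the graph splits into \<open>k\<close> dominating sets.
  If at least two colors are available, Bob spends his first \<open>k\<close> moves coloring one vertex of each
  group with color 1, which gives a set \<open>S\<close>. Alice has had too few moves to color all the vertices
  attached to \<open>S\<close>, so Bob can color one of them with color 1 as well, and then color 2 does not
  dominate that vertex.
\<close>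

section \<open>Histories and plays consistent with a strategy\<close>

lemma legal_history_snoc:
  "legal_history G q (h @ [(v, c)]) \<longleftrightarrow>
     legal_history G q h \<and> v \<in> pverts G \<and> v \<notin> fst ` set h \<and> c \<in> {1..q}"
  unfolding legal_history_def by auto

lemma follows_snoc:
  "follows X \<sigma> (h @ [mv]) \<longleftrightarrow> follows X \<sigma> h \<and> (to_move X h = Alice \<longrightarrow> mv = \<sigma> h)"
  unfolding follows_def by (auto simp: less_Suc_eq nth_append)

lemma to_move_snoc: "to_move X (h @ [mv]) = opponent (to_move X h)"
  by (cases X) (auto simp: to_move_def)

lemma card_colored_vertices:
  "legal_history G q h \<Longrightarrow> card (fst ` set h) = length h"
  unfolding legal_history_def by (metis distinct_card length_map set_map)

lemma uncolored_vertex_exists: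
  assumes "legal_history G q h" "length h < card A"
  obtains v where "v \<in> A" "v \<notin> fst ` set h"
proof -
  have "\<not> A \<subseteq> fst ` set h"
    using card_mono[of "fst ` set h" A] card_colored_vertices[OF assms(1)] assms(2) by auto
  then show ?thesis using that by blast
qed

text \<open>\<open>Alice_strategy\<close> guarantees a legal reply only at unfinished histories; the
  count of moves shows that a vertex is left.\<close>

lemma incomplete_history:
  assumes "legal_history G q h" "length h < card (pverts G)"
  shows "\<not> complete_history G h"
  using assms card_colored_vertices unfolding complete_history_def by fastforce

lemma legal_history_color_unique:
  assumes "legal_history G q h" "(v, c) \<in> set h" "(v, d) \<in> set h"
  shows "c = d"
  using assms unfolding legal_history_def by (metis eq_key_imp_eq_value)

text \<open>\<open>winning_strategy\<close> judges complete histories only, so a position already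
  lost for Alice has to be played out. Alice continues with \<open>\<sigma>\<close>, and Bob colors
  any uncolored vertex with color 1.\<close>

lemma extend_play:
  assumes fin: "finite (pverts G)" and q: "1 \<le> q" and strat: "Alice_strategy G q X \<sigma>"
    and "legal_history G q h" "follows X \<sigma> h"
  shows "\<exists>g. legal_history G q (h @ g) \<and> follows X \<sigma> (h @ g) \<and> complete_history G (h @ g)"
  using assms(4,5)
proof (induction "card (pverts G) - length h" arbitrary: h rule: less_induct)
  case less
  show ?case
  proof (cases "complete_history G h")
    case True
    then show ?thesis using less.prems by (intro exI[of _ "[]"]) simp
  next
    case False
    obtain mv where mv: "legal_history G q (h @ [mv])" "follows X \<sigma> (h @ [mv])"
    proof (cases "to_move X h")
      case Alice
      then show ?thesis
        using that[of "\<sigma> h"] strat less.prems False by (simp add: Alice_strategy_def follows_snoc)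
    next
      case Bob
      obtain v where "v \<in> pverts G" "v \<notin> fst ` set h"
        using False less.prems(1) unfolding complete_history_def legal_history_def by blast
      then show ?thesis
        using that[of "(v, 1)"] less.prems q Bob by (simp add: legal_history_snoc follows_snoc)
    qed
    \<comment> \<open>Subtraction is truncated; the measure drops because the longer history still
      fits into the vertex set.\<close>
    have "fst ` set (h @ [mv]) \<subseteq> pverts G"
      using mv(1) by (simp add: legal_history_def)
    from card_mono[OF fin this] have "length (h @ [mv]) \<le> card (pverts G)"
      by (simp only: card_colored_vertices[OF mv(1)])
    then have "card (pverts G) - length (h @ [mv]) < card (pverts G) - length h"
      by simp
    from less.hyps[OF this mv] obtain g where
      "legal_history G q ((h @ [mv]) @ g)" "follows X \<sigma> ((h @ [mv]) @ g)"
      "complete_history G ((h @ [mv]) @ g)" by blast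
    then show ?thesis by (intro exI[of _ "mv # g"]) simp
  qed
qed

section \<open>Bob's play against two or more colors\<close>

lemma Bob_collects_transversal:
  fixes V :: "nat \<Rightarrow> 'a set"
  assumes q: "1 \<le> q" and strat: "Alice_strategy G q X \<sigma>"
    and V: "\<And>j. j < m \<Longrightarrow> V j \<subseteq> pverts G \<and> 2 * m + 1 < card (V j)"
    and G: "2 * m + 1 < card (pverts G)"
    and "j \<le> m"
  shows "\<exists>h f. legal_history G q h \<and> follows X \<sigma> h \<and> to_move X h = Bob \<and> length h \<le> 2 * j + 1 \<and>
           (\<forall>i<j. f i \<in> V i \<and> (f i, 1) \<in> set h)"
  using \<open>j \<le> m\<close>
proof (induction j)
  case 0
  have nil: "legal_history G q []" "follows X \<sigma> []"
    by (simp_all add: legal_history_def follows_def)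
  show ?case
  \<comment> \<open>The extra 1 in the length bound pays for Alice's opening move when she begins;
    from then on each round adds two moves.\<close>
  proof (cases X)
    case Bob
    then show ?thesis using nil by (intro exI[of _ "[]"]) (auto simp: to_move_def)
  next
    case Alice
    have "\<not> complete_history G []" using nil(1) G by (intro incomplete_history) auto
    moreover have X: "to_move X [] = Alice" using Alice by (simp add: to_move_def)
    ultimately have "legal_history G q ([] @ [\<sigma> []])"
      using strat nil(1) unfolding Alice_strategy_def by blast
    moreover have "follows X \<sigma> ([] @ [\<sigma> []])" using nil(2) by (simp only: follows_snoc simp_thms)
    moreover have "to_move X ([] @ [\<sigma> []]) = Bob" unfolding to_move_snoc X by simp
    ultimately show ?thesis by (intro exI[of _ "[\<sigma> []]"]) auto
  qed
next
  case (Suc j)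
  then obtain h f where h: "legal_history G q h" "follows X \<sigma> h" "to_move X h = Bob"
    "length h \<le> 2 * j + 1" and f: "\<forall>i<j. f i \<in> V i \<and> (f i, 1) \<in> set h"
    by auto
  \<comment> \<open>At most \<open>2 * j + 1\<close> moves cannot exhaust \<open>V j\<close>,
    whatever Alice has colored.\<close>
  have "length h < card (V j)" using h(4) V[of j] Suc.prems by linarith
  then obtain v where v: "v \<in> V j" "v \<notin> fst ` set h"
    using uncolored_vertex_exists[OF h(1)] by blast
  define h' where "h' = h @ [(v, 1)]"
  have h': "legal_history G q h'" "follows X \<sigma> h'" "to_move X h' = Alice"
    using h v q V[of j] Suc.prems
    by (auto simp: h'_def legal_history_snoc follows_snoc to_move_snoc)
  moreover have "\<not> complete_history G h'"
    using h'(1) h(4) G Suc.prems by (intro incomplete_history) (auto simp: h'_def)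
  ultimately have "legal_history G q (h' @ [\<sigma> h'])"
    using strat unfolding Alice_strategy_def by blast
  moreover have "follows X \<sigma> (h' @ [\<sigma> h'])" "to_move X (h' @ [\<sigma> h']) = Bob"
    using h' unfolding follows_snoc to_move_snoc by simp_all
  moreover have "length (h' @ [\<sigma> h']) \<le> 2 * Suc j + 1" using h(4) by (simp add: h'_def)
  moreover have "\<forall>i<Suc j. (f(j := v)) i \<in> V i \<and> ((f(j := v)) i, 1) \<in> set (h' @ [\<sigma> h'])"
    using f v by (auto simp: h'_def less_Suc_eq)
  ultimately show ?case by blast
qed

text \<open>The transversal \<open>f\<close> is fixed only by the play, hence \<open>W\<close> is
  demanded for every \<open>f\<close>. Once Bob also colors a vertex with all its neighbors in the
  range of \<open>f\<close>, its closed neighborhood is entirely of color 1 and misses color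
  2.\<close>

proposition Bob_wins_if_transversals_attached:
  fixes V :: "nat \<Rightarrow> 'a set"
  assumes fin: "finite (pverts G)" and q: "2 \<le> q"
    and V: "\<And>j. j < m \<Longrightarrow> V j \<subseteq> pverts G \<and> 2 * m + 1 < card (V j)"
    and W: "\<And>f. (\<And>j. j < m \<Longrightarrow> f j \<in> V j) \<Longrightarrow>
       2 * m + 1 < card {w \<in> pverts G. \<forall>u. (u, w) \<in> parcs G \<longrightarrow> u \<in> f ` {..<m}}"
  shows "\<not> winning_strategy G q X \<sigma>"
proof
  assume win: "winning_strategy G q X \<sigma>"
  then have strat: "Alice_strategy G q X \<sigma>" by (simp add: winning_strategy_def)
  let ?W = "\<lambda>f. {w \<in> pverts G. \<forall>u. (u, w) \<in> parcs G \<longrightarrow> u \<in> f ` {..<m}}"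
  \<comment> \<open>An arbitrary choice of representatives turns \<open>W\<close> into a lower bound
    for the number of vertices, which also covers \<open>m = 0\<close>.\<close>
  have "(SOME v. v \<in> V j) \<in> V j" if "j < m" for j
  proof -
    have "V j \<noteq> {}" using V[OF that] by auto
    then show ?thesis by (simp add: some_in_eq)
  qed
  from W[OF this] have "2 * m + 1 < card (?W (\<lambda>j. SOME v. v \<in> V j))" by simp
  also have "\<dots> \<le> card (pverts G)" using fin by (intro card_mono) auto
  finally have G: "2 * m + 1 < card (pverts G)" .
  obtain h f where h: "legal_history G q h" "follows X \<sigma> h" "to_move X h = Bob"
    "length h \<le> 2 * m + 1" and f: "\<forall>i<m. f i \<in> V i \<and> (f i, 1) \<in> set h"
    using Bob_collects_transversal[where V = V and j = m, OF _ strat V G] q by auto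
  have "length h < card (?W f)" using h(4) W[of f] f by fastforce
  then obtain w where w: "w \<in> ?W f" "w \<notin> fst ` set h"
    using uncolored_vertex_exists[OF h(1)] by blast
  define h' where "h' = h @ [(w, 1)]"
  have h': "legal_history G q h'" "follows X \<sigma> h'"
    using h w q by (auto simp: h'_def legal_history_snoc follows_snoc)
  obtain g where g: "legal_history G q (h' @ g)" "follows X \<sigma> (h' @ g)"
    "complete_history G (h' @ g)"
    using extend_play[OF fin _ strat h'] q by auto
  then have "Alice_wins G q (h' @ g)" using win by (simp add: winning_strategy_def)
  then have "dominating_set G (color_class (h' @ g) 2)" using q by (simp add: Alice_wins_def)
  then obtain u where u: "u = w \<or> (u, w) \<in> parcs G" "(u, 2) \<in> set (h' @ g)"
    using w(1) unfolding dominating_set_def color_class_def by blast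
  have "(u, 1) \<in> set (h' @ g)" using u(1) w(1) f by (auto simp: h'_def)
  from legal_history_color_unique[OF g(1) this u(2)] show False by simp
qed

section \<open>Lower bounds for the game number and the domatic number\<close>

lemma one_color_winning_strategy:
  "\<exists>\<sigma>. winning_strategy G 1 X \<sigma>"
proof -
  define \<sigma> :: "('a \<times> nat) list \<Rightarrow> 'a \<times> nat"
    where "\<sigma> h = (SOME v. v \<in> pverts G \<and> v \<notin> fst ` set h, 1)" for h
  have "legal_history G 1 (h @ [\<sigma> h])" if "legal_history G 1 h" "\<not> complete_history G h" for h
  proof -
    have "\<exists>v. v \<in> pverts G \<and> v \<notin> fst ` set h"
      using that unfolding legal_history_def complete_history_def by blast
    from someI_ex[OF this] show ?thesis using that by (simp add: \<sigma>_def legal_history_snoc)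
  qed
  moreover have "Alice_wins G 1 h" if "legal_history G 1 h" "complete_history G h" for h
  proof -
    \<comment> \<open>Color 1 is the only color, so any completed coloring wins;
      \<open>\<sigma>\<close> merely has to find uncolored vertices.\<close>
    have "color_class h 1 = pverts G"
      using that unfolding color_class_def legal_history_def complete_history_def by force
    then show ?thesis by (simp add: Alice_wins_def dominating_set_def)
  qed
  ultimately show ?thesis
    by (intro exI[of _ \<sigma>]) (auto simp: winning_strategy_def Alice_strategy_def)
qed

text \<open>\<open>Max_ge\<close> needs a finite set. A partition is a set of subsets of the vertex
  set, so the power set bounds its cardinality.\<close>

lemma domatic_number_geI:
  assumes "finite (pverts G)" "partition_on (pverts G) P" "\<And>S. S \<in> P \<Longrightarrow> dominating_set G S"
  shows "card P \<le> domatic_number G"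
proof -
  have "card Q \<le> card (Pow (pverts G))" if "partition_on (pverts G) Q" for Q
    using that assms(1) by (intro card_mono) (auto simp: partition_on_def)
  then have "finite {card P | P. partition_on (pverts G) P \<and> (\<forall>S\<in>P. dominating_set G S)}"
    by (intro finite_subset[OF _ finite_atMost[of "card (Pow (pverts G))"]]) auto
  then show ?thesis unfolding domatic_number_def using assms(2,3) by (intro Max_ge) auto
qed

section \<open>The graph and its arcs\<close>

text \<open>
  The clique is \<open>{..<n}\<close> with \<open>n = k * (2 * k + 2)\<close>, and its groups are the residue classes
  modulo \<open>k\<close>. The number \<open>n + prod_encode (set_encode S, i)\<close> is the \<open>i\<close>-th vertex attached to \<open>S\<close>.
\<close>

definition clique_size :: "nat \<Rightarrow> nat" where
  "clique_size k = k * (2 * k + 2)"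

definition attached_vertex :: "nat \<Rightarrow> nat set \<Rightarrow> nat \<Rightarrow> nat" where
  "attached_vertex k S i = clique_size k + prod_encode (set_encode S, i)"

definition group_hitting_sets :: "nat \<Rightarrow> nat set set" where
  "group_hitting_sets k = {S. S \<subseteq> {..<clique_size k} \<and> (\<forall>j<k. \<exists>x\<in>S. x mod k = j)}"

definition attached_arcs :: "nat \<Rightarrow> (nat \<times> nat) set" where
  "attached_arcs k =
     {(x, attached_vertex k S i) | x S i. S \<in> group_hitting_sets k \<and> x \<in> S \<and> i < 2 * k + 2}"

definition transversal_graph :: "nat \<Rightarrow> nat pair_pre_digraph" where
  "transversal_graph k =
     \<lparr> pverts = {..<clique_size k} \<union>
         case_prod (attached_vertex k) ` (group_hitting_sets k \<times> {..<2 * k + 2}),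
       parcs = {(x, y). x < clique_size k \<and> y < clique_size k \<and> x \<noteq> y} \<union>
         attached_arcs k \<union> (attached_arcs k)\<inverse> \<rparr>"

lemma attached_vertex_ge: "\<not> attached_vertex k S i < clique_size k"
  by (simp add: attached_vertex_def)

lemma group_hitting_sets_less:
  "S \<in> group_hitting_sets k \<Longrightarrow> x \<in> S \<Longrightarrow> x < clique_size k"
  by (auto simp: group_hitting_sets_def)

lemma finite_group_hitting_sets: "finite (group_hitting_sets k)"
  by (rule finite_subset[of _ "Pow {..<clique_size k}"]) (auto simp: group_hitting_sets_def)

text \<open>\<open>set_encode\<close> is injective only on finite sets; membership in
  \<open>group_hitting_sets\<close> supplies the finiteness.\<close>

lemma attached_vertex_eq_iff:
  assumes "S \<in> group_hitting_sets k" "T \<in> group_hitting_sets k"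
  shows "attached_vertex k S i = attached_vertex k T j \<longleftrightarrow> S = T \<and> i = j"
proof -
  have "finite S" "finite T"
    using assms by (auto simp: group_hitting_sets_def intro: finite_subset)
  then show ?thesis by (auto simp: attached_vertex_def set_encode_eq)
qed

lemma finite_pverts_transversal_graph: "finite (pverts (transversal_graph k))"
  by (simp add: transversal_graph_def finite_group_hitting_sets)

lemma pair_graph_transversal_graph: "pair_graph (transversal_graph k)"
proof -
  let ?G = "transversal_graph k"
  have wf: "parcs ?G \<subseteq> pverts ?G \<times> pverts ?G"
    by (auto simp: transversal_graph_def attached_arcs_def dest: group_hitting_sets_less)
  have "u \<noteq> v" if "(u, v) \<in> parcs ?G" for u v
    using that attached_vertex_ge
    by (auto simp: transversal_graph_def attached_arcs_def dest!: group_hitting_sets_less)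
  moreover have "sym (parcs ?G)"
    by (auto simp: transversal_graph_def sym_def)
  moreover have "finite (parcs ?G)"
    using finite_subset[OF wf] finite_pverts_transversal_graph by blast
  ultimately show ?thesis
    using wf finite_pverts_transversal_graph
    by unfold_locales (auto simp: symmetric_def)
qed

text \<open>Clique arcs and reversed attached arcs end below \<open>clique_size k\<close>, so only
  the arcs coming from \<open>S\<close> reach this vertex.\<close>

lemma parcs_to_attached_vertex:
  assumes "S \<in> group_hitting_sets k" "i < 2 * k + 2"
  shows "(x, attached_vertex k S i) \<in> parcs (transversal_graph k) \<longleftrightarrow> x \<in> S"
  using assms attached_vertex_ge[of k]
  by (auto simp: transversal_graph_def attached_arcs_def attached_vertex_eq_iff
      dest: group_hitting_sets_less)

section \<open>Domatic number and game number of the graph\<close>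

lemma transversal_graph_domatic_number:
  assumes "1 \<le> k"
  shows "k \<le> domatic_number (transversal_graph k)"
proof -
  let ?G = "transversal_graph k"
  \<comment> \<open>The classes also take in the attached vertices, by the residues of their
    numbers. Any distribution of these would do, as the clique vertices of each class already
    dominate the graph.\<close>
  let ?C = "\<lambda>j. {v \<in> pverts ?G. v mod k = j}"
  \<comment> \<open>The number \<open>j\<close> is itself a clique vertex of class \<open>j\<close>:
    it shows the class nonempty, dominates the clique and separates the classes.\<close>
  have less: "j < clique_size k" if "j < k" for j
    using that by (simp add: clique_size_def trans_less_add2)
  have mem: "j \<in> ?C j" if "j < k" for j
    using that less by (simp add: transversal_graph_def)
  have "partition_on (pverts ?G) (?C ` {..<k})"
  proof (rule partition_onI)
    show "\<Union> (?C ` {..<k}) = pverts ?G" using assms by auto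
    show "{} \<notin> ?C ` {..<k}" using mem by blast
  qed (auto simp: disjnt_def)
  moreover have "dominating_set ?G S" if S: "S \<in> ?C ` {..<k}" for S
  proof -
    obtain j where j: "j < k" "S = ?C j" using S by auto
    have "v \<in> S \<or> (\<exists>u\<in>S. (u, v) \<in> parcs ?G)" if v: "v \<in> pverts ?G" for v
    proof (cases "v < clique_size k")
      case True
      then have "v = j \<or> (j, v) \<in> parcs ?G"
        using less[OF j(1)] by (auto simp: transversal_graph_def)
      then show ?thesis using mem[OF j(1)] j(2) by blast
    next
      case False
      then obtain T i where T: "T \<in> group_hitting_sets k" "i < 2 * k + 2"
        "v = attached_vertex k T i"
        using v by (auto simp: transversal_graph_def)
      \<comment> \<open>\<open>T\<close> meets every group, and all of \<open>T\<close> is adjacent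
        to \<open>v\<close>.\<close>
      obtain x where x: "x \<in> T" "x mod k = j"
        using T(1) j(1) unfolding group_hitting_sets_def by blast
      then show ?thesis
        using group_hitting_sets_less[OF T(1) x(1)] parcs_to_attached_vertex[OF T(1,2)] T(3) j(2)
        by (auto simp: transversal_graph_def)
    qed
    then show ?thesis using j(2) by (auto simp: dominating_set_def)
  qed
  ultimately have "card (?C ` {..<k}) \<le> domatic_number ?G"
    using finite_pverts_transversal_graph by (intro domatic_number_geI) auto
  moreover have "inj_on ?C {..<k}"
  proof (rule inj_onI)
    fix i j assume "i \<in> {..<k}" "j \<in> {..<k}" "?C i = ?C j"
    then have "i \<in> ?C j" using mem[of i] by blast
    then show "i = j" using \<open>i \<in> {..<k}\<close> by simp
  qed
  ultimately show ?thesis by (simp add: card_image)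
qed

text \<open>At most \<open>2 * k + 1\<close> moves precede Bob's decisive one. Each group and each
  family of vertices attached to one set has \<open>2 * k + 2\<close> members, one more than
  that.\<close>

lemma transversal_graph_Bob_wins:
  assumes "2 \<le> q"
  shows "\<not> winning_strategy (transversal_graph k) q X \<sigma>"
proof (rule Bob_wins_if_transversals_attached[OF finite_pverts_transversal_graph assms])
  let ?G = "transversal_graph k"
  let ?V = "\<lambda>j. {x. x < clique_size k \<and> x mod k = j}"
  show "?V j \<subseteq> pverts ?G \<and> 2 * k + 1 < card (?V j)" if "j < k" for j
  proof
    have "j + k * a < clique_size k" if "a < 2 * k + 2" for a
    proof -
      have "j + k * a < k * Suc a" using \<open>j < k\<close> by simp
      also have "\<dots> \<le> clique_size k" using that unfolding clique_size_def by (intro mult_le_mono2) simp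
      finally show ?thesis .
    qed
    then have "(\<lambda>a. j + k * a) ` {..<2 * k + 2} \<subseteq> ?V j" using that by auto
    then have "card ((\<lambda>a. j + k * a) ` {..<2 * k + 2}) \<le> card (?V j)"
      by (intro card_mono) auto
    moreover have "inj_on (\<lambda>a. j + k * a) {..<2 * k + 2}"
      using that by (auto simp: inj_on_def)
    ultimately show "2 * k + 1 < card (?V j)" by (simp add: card_image)
  qed (auto simp: transversal_graph_def)
  fix f assume f: "\<And>j. j < k \<Longrightarrow> f j \<in> ?V j"
  let ?S = "f ` {..<k}"
  have S: "?S \<in> group_hitting_sets k"
    using f by (auto simp: group_hitting_sets_def)
  let ?W = "{w \<in> pverts ?G. \<forall>u. (u, w) \<in> parcs ?G \<longrightarrow> u \<in> ?S}"
  have "attached_vertex k ?S ` {..<2 * k + 2} \<subseteq> ?W"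
    using S parcs_to_attached_vertex[OF S] by (auto simp: transversal_graph_def)
  then have "card (attached_vertex k ?S ` {..<2 * k + 2}) \<le> card ?W"
    using finite_pverts_transversal_graph by (intro card_mono) auto
  moreover have "inj_on (attached_vertex k ?S) {..<2 * k + 2}"
    using S by (auto simp: inj_on_def attached_vertex_eq_iff)
  ultimately show "2 * k + 1 < card ?W" by (simp add: card_image)
qed

lemma transversal_graph_domatic_game_number:
  "domatic_game_number (transversal_graph k) X = 1"
proof -
  \<comment> \<open>Showing that the set is exactly \<open>{1}\<close> lets \<open>Max\<close> be
    evaluated without a separate finiteness argument.\<close>
  have "{q. 1 \<le> q \<and> (\<exists>\<sigma>. winning_strategy (transversal_graph k) q X \<sigma>)} = {1}"
  proof (intro set_eqI iffI)
    fix q assume "q \<in> {q. 1 \<le> q \<and> (\<exists>\<sigma>. winning_strategy (transversal_graph k) q X \<sigma>)}"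
    then have "1 \<le> q" "\<not> 2 \<le> q" using transversal_graph_Bob_wins by auto
    then show "q \<in> {1}" by simp
  qed (simp add: one_color_winning_strategy[unfolded One_nat_def])
  then show ?thesis by (simp add: domatic_game_number_def)
qed

theorem theorem2p12:
  fixes k :: nat
  assumes "k \<ge> 1"
  shows "\<exists>G :: nat pair_pre_digraph. pair_graph G \<and> pverts G \<noteq> {} \<and>
           domatic_number G \<ge> k \<and> (\<forall>X. domatic_game_number G X = 1)"
proof (intro exI conjI allI)
  have "0 \<in> pverts (transversal_graph k)"
    using assms by (simp add: transversal_graph_def clique_size_def)
  then show "pverts (transversal_graph k) \<noteq> {}" by blast
qed (rule pair_graph_transversal_graph transversal_graph_domatic_number[OF assms]
       transversal_graph_domatic_game_number)+

end
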